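(* Let $n \geq 3$. Every 1-visibility graph with $n$ vertices has at most $4n-8$ edges.
   Context: Graphs are finite, simple and undirected. A 1-visibility representation of a graph $G=(V,E)$ assigns to each vertex $v$ a closed horizontal segment $\Gamma(v)$ (vertex-segment, possibly degenerate) and to each edge $e=(u,v)$ a vertical segment $\Gamma(e)$ (edge-segment) from some point on $\Gamma(u)$ to some point on $\Gamma(v)$. The endpoints of all segments are grid points (integer coordinates). Distinct vertex-segments do not overlap (they are disjoint), and distinct edge-segments do not overlap in their interiors. An edge-segment $\Gamma(e)$ crosses a vertex-segment $\Gamma(w)$ if they intersect and $w$ is not an end vertex of $e$. Each vertex-segment is crossed by at most one edge-segment, and each edge-segment crosses at most one vertex-segment. Visibility is in the weak sense: vertex-segments that see each other need not be adjacent. A 1-visibility graph is a graph that has a 1-visibility representation. *)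

theory Defs
  imports "HOL-Analysis.Analysis"
begin

definition simple_graph :: "'a set \<Rightarrow> 'a set set \<Rightarrow> bool" where
  "simple_graph V E \<longleftrightarrow> finite V \<and> (\<forall>e\<in>E. e \<subseteq> V \<and> card e = 2)"

type_synonym point = "real \<times> real"

definition grid_point :: "point \<Rightarrow> bool" where
  "grid_point p \<longleftrightarrow> fst p \<in> \<int> \<and> snd p \<in> \<int>"

definition vertex_segment :: "point set \<Rightarrow> bool" where
  "vertex_segment S \<longleftrightarrow>
     (\<exists>p q. grid_point p \<and> grid_point q \<and> snd p = snd q \<and> S = closed_segment p q)"

definition edge_segment :: "point set \<Rightarrow> point set \<Rightarrow> point set \<Rightarrow> bool" where
  "edge_segment A B S \<longleftrightarrow>
     (\<exists>p q. p \<in> A \<and> q \<in> B \<and> grid_point p \<and> grid_point q \<and> fst p = fst q \<and>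
        S = closed_segment p q)"

definition crosses ::
  "('a \<Rightarrow> point set) \<Rightarrow> ('a set \<Rightarrow> point set) \<Rightarrow> 'a set \<Rightarrow> 'a \<Rightarrow> bool" where
  "crosses \<Gamma>V \<Gamma>E e w \<longleftrightarrow> w \<notin> e \<and> \<Gamma>E e \<inter> \<Gamma>V w \<noteq> {}"

text \<open>
  The interior of an edge-segment is its interior relative to the line that carries it:
  edge-segments have empty interior in the plane.
  An edge-segment is never degenerate, because it joins points of two disjoint vertex-segments.
  Visibility is weak, so nothing is required of non-adjacent vertices.
\<close>

definition one_visibility_representation ::
  "'a set \<Rightarrow> 'a set set \<Rightarrow> ('a \<Rightarrow> point set) \<Rightarrow> ('a set \<Rightarrow> point set) \<Rightarrow> bool" where
  "one_visibility_representation V E \<Gamma>V \<Gamma>E \<longleftrightarrow>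
     (\<forall>v\<in>V. vertex_segment (\<Gamma>V v)) \<and>
     (\<forall>u\<in>V. \<forall>v\<in>V. {u, v} \<in> E \<longrightarrow> edge_segment (\<Gamma>V u) (\<Gamma>V v) (\<Gamma>E {u, v})) \<and>
     (\<forall>u\<in>V. \<forall>v\<in>V. u \<noteq> v \<longrightarrow> \<Gamma>V u \<inter> \<Gamma>V v = {}) \<and>
     (\<forall>e\<in>E. \<forall>f\<in>E. e \<noteq> f \<longrightarrow> rel_interior (\<Gamma>E e) \<inter> rel_interior (\<Gamma>E f) = {}) \<and>
     (\<forall>w\<in>V. \<exists>\<^sub>\<le>\<^sub>1e. e \<in> E \<and> crosses \<Gamma>V \<Gamma>E e w) \<and>
     (\<forall>e\<in>E. \<exists>\<^sub>\<le>\<^sub>1w. w \<in> V \<and> crosses \<Gamma>V \<Gamma>E e w)"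

definition one_visibility_graph :: "'a set \<Rightarrow> 'a set set \<Rightarrow> bool" where
  "one_visibility_graph V E \<longleftrightarrow>
     simple_graph V E \<and> (\<exists>\<Gamma>V \<Gamma>E. one_visibility_representation V E \<Gamma>V \<Gamma>E)"

end

theory Submission
  imports Defs
begin

text \<open>
  An edge-segment that crosses the vertex-segment of \<open>w\<close> has an end above and an end below \<open>w\<close>, so
  neither a lowest nor a highest vertex-segment is crossed, and at most \<open>n - 2\<close> edges cross a
  vertex-segment. The uncrossed edges are counted by a left-to-right sweep that maintains the list
  of vertex-segments met by the vertical sweep line, ordered by height. The ends of an uncrossed
  edge are neighbours in that list at some time. Inserting a segment creates at most two new
  neighbouring pairs and deleting one creates at most one, which gives \<open>3 n\<close> pairs; the losses at the
  ends of the list, at the beginning and at the end of the sweep improve this to \<open>3 n - 6\<close>.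
\<close>

section \<open>Neighbouring pairs in a list under insertions and deletions\<close>

fun adj :: "'a list \<Rightarrow> ('a \<times> 'a) set" where
  "adj (u # v # xs) = insert (u, v) (adj (v # xs))"
| "adj _ = {}"

lemma adj_append:
  "xs \<noteq> [] \<Longrightarrow> ys \<noteq> [] \<Longrightarrow> adj (xs @ ys) = insert (last xs, hd ys) (adj xs \<union> adj ys)"
proof (induction xs rule: adj.induct)
  case ("2_2" v)
  then show ?case by (cases ys) auto
qed auto

lemma finite_adj [simp]: "finite (adj xs)"
  by (induction xs rule: adj.induct) auto

text \<open>
  In \<open>sweep i d L D\<close>, the list \<open>L\<close> is reached after \<open>i\<close> insertions and \<open>d\<close> deletions, and \<open>D\<close>
  collects the pairs that have been neighbours so far.
\<close>

inductive sweep :: "nat \<Rightarrow> nat \<Rightarrow> 'a list \<Rightarrow> ('a \<times> 'a) set \<Rightarrow> bool" where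
  start: "sweep 0 0 [] {}"
| ins: "sweep i d (xs @ ys) D \<Longrightarrow> sweep (Suc i) d (xs @ w # ys) (D \<union> adj (xs @ w # ys))"
| del: "sweep i d (xs @ w # ys) D \<Longrightarrow> sweep i (Suc d) (xs @ ys) (D \<union> adj (xs @ ys))"

lemma card_Un_le_insert:
  assumes "finite D" "S \<subseteq> insert p D"
  shows "card (D \<union> S) \<le> card D + 1"
proof -
  have "card (D \<union> S) \<le> card (insert p D)"
    using assms by (intro card_mono) auto
  then show ?thesis using card_insert_le_m1[of "Suc (card D)" D p] by simp
qed

lemma card_Un_le_insert2:
  assumes "finite D" "S \<subseteq> insert p (insert q D)"
  shows "card (D \<union> S) \<le> card D + 2"
proof -
  have "card (D \<union> S) \<le> card (insert p (insert q D))"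
    using assms by (intro card_mono) auto
  also have "\<dots> \<le> card D + 2"
    using assms(1) by (simp add: card_insert_if)
  finally show ?thesis .
qed

text \<open>
  Here \<open>m\<close> is the length of the current list, \<open>c\<close> the number of pairs collected so far, and \<open>p\<close>
  says that the first and the last element of the list form one of these pairs. The second
  alternative for long lists is the case without any loss so far: then all operations took place
  strictly between the two vertices inserted first, which are still the ends of the list.
\<close>

definition sweep_bound :: "nat \<Rightarrow> nat \<Rightarrow> nat \<Rightarrow> nat \<Rightarrow> bool \<Rightarrow> bool" where
  "sweep_bound i d m c p \<longleftrightarrow>
     (i \<le> 1 \<longrightarrow> c = 0) \<and> (i = 2 \<longrightarrow> c \<le> 1) \<and>
     (i \<ge> 3 \<longrightarrow>
       (m = 0 \<longrightarrow> c + 6 \<le> 2 * i + d) \<and>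
       (m = 1 \<longrightarrow> c + 5 \<le> 2 * i + d) \<and>
       (m = 2 \<longrightarrow> c + 4 \<le> 2 * i + d) \<and>
       (m \<ge> 3 \<longrightarrow> c + 4 \<le> 2 * i + d \<or> (c + 3 \<le> 2 * i + d \<and> p)))"

text \<open>Flattening the invariant into six cases with linear hypotheses reduces each transition
  lemma below to linear arithmetic.\<close>

lemma sweep_bound_cases:
  assumes "sweep_bound i d m c p"
  obtains "i \<le> 1" "c = 0" | "i = 2" "c \<le> 1"
    | "3 \<le> i" "m = 0" "c + 6 \<le> 2 * i + d"
    | "3 \<le> i" "m = 1" "c + 5 \<le> 2 * i + d"
    | "3 \<le> i" "m \<ge> 2" "c + 4 \<le> 2 * i + d"
    | "3 \<le> i" "m \<ge> 3" "c + 3 \<le> 2 * i + d" p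
proof -
  consider "i \<le> 1" | "i = 2" | "i \<ge> 3" "m = 0" | "i \<ge> 3" "m = 1" | "i \<ge> 3" "m = 2"
    | "i \<ge> 3" "m \<ge> 3" by linarith
  then show thesis using assms that unfolding sweep_bound_def
    by cases (simp_all, blast)
qed

lemma sweep_bound_insert_empty:
  assumes "sweep_bound i d 0 c p" "i = d"
  shows "sweep_bound (Suc i) d (Suc 0) c p'"
  by (rule sweep_bound_cases[OF assms(1)]; insert assms(2-); simp add: sweep_bound_def; linarith)

text \<open>An insertion raises the budget \<open>2 * i + d\<close> by two but costs at most one
  pair here. The spare unit repays the exceptional alternative, so the result holds for every
  \<open>p'\<close>.\<close>

lemma sweep_bound_insert_end:
  assumes "sweep_bound i d m c p" "i = d + m" "1 \<le> m" "c' \<le> c + 1"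
  shows "sweep_bound (Suc i) d (Suc m) c' p'"
  by (rule sweep_bound_cases[OF assms(1)]; insert assms(2-); simp add: sweep_bound_def; linarith)

text \<open>Both units may be spent. For \<open>i = 2\<close> this creates the exceptional
  alternative: up to three pairs after three insertions, with budget 6.\<close>

lemma sweep_bound_insert_middle:
  assumes "sweep_bound i d m c p" "i = d + m" "2 \<le> m" "c' \<le> c + 2" "i = 2 \<longrightarrow> p'" "p \<longrightarrow> p'"
  shows "sweep_bound (Suc i) d (Suc m) c' p'"
  by (rule sweep_bound_cases[OF assms(1)]; insert assms(2-); simp add: sweep_bound_def; linarith)

text \<open>The budget grows by one and no pair arises. This unit pays for the stronger bound of a
  shorter list, or for leaving the exceptional alternative.\<close>

lemma sweep_bound_delete_end:
  assumes "sweep_bound i d (Suc m) c p" "i = d + Suc m"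
  shows "sweep_bound i (Suc d) m c p'"
  by (rule sweep_bound_cases[OF assms(1)]; insert assms(2-); simp add: sweep_bound_def; linarith)

text \<open>The unit gained is spent on the pair that closes the gap. The critical case is a list of
  length 3 in the exceptional alternative: the two survivors are its ends, whose pair is already
  counted by \<open>p\<close>, so the ordinary bound for length 2 is reached.\<close>

lemma sweep_bound_delete_middle:
  assumes "sweep_bound i d (Suc m) c p" "i = d + Suc m" "2 \<le> m" "c' \<le> c + 1"
    "p \<longrightarrow> p'" "m = 2 \<and> p \<longrightarrow> c' = c"
  shows "sweep_bound i (Suc d) m c' p'"
  by (rule sweep_bound_cases[OF assms(1)]; insert assms(2-); simp add: sweep_bound_def; linarith)

text \<open>For a complete sweep of \<open>n \<ge> 3\<close> vertices, with \<open>L = []\<close>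
  and \<open>i = d = n\<close>, the clause for length 0 yields
  \<open>card D + 6 \<le> 3 * n\<close>.\<close>

lemma sweep_invariant:
  assumes "sweep i d L D"
  shows "finite D \<and> adj L \<subseteq> D \<and> i = d + length L \<and>
    sweep_bound i d (length L) (card D) ((hd L, last L) \<in> D)"
  using assms
proof induction
  case start
  then show ?case by (simp add: sweep_bound_def)
next
  case (ins i d xs ys D w)
  let ?L = "xs @ w # ys" and ?D = "D \<union> adj (xs @ w # ys)"
  have fin: "finite D" and sub: "adj (xs @ ys) \<subseteq> D" and len: "i = d + length (xs @ ys)"
    and IH: "sweep_bound i d (length (xs @ ys)) (card D) ((hd (xs @ ys), last (xs @ ys)) \<in> D)"
    using ins.IH by auto
  have lenL: "length ?L = Suc (length (xs @ ys))" by simp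
  have "sweep_bound (Suc i) d (length ?L) (card ?D) ((hd ?L, last ?L) \<in> ?D)"
  proof (cases "xs = [] \<and> ys = []")
    case True
    then show ?thesis using IH len sweep_bound_insert_empty by fastforce
  next
    case nonempty: False
    then have len1: "1 \<le> length (xs @ ys)"
      by (cases xs; cases ys) auto
    show ?thesis
    proof (cases "xs = [] \<or> ys = []")
      case True
      have "\<exists>p. adj ?L \<subseteq> insert p D"
      proof (cases "xs = []")
        case True
        then have "adj ?L \<subseteq> insert (w, hd ys) D" using nonempty sub by (cases ys) auto
        then show ?thesis by blast
      next
        case False
        then have "adj ?L \<subseteq> insert (last xs, w) D"
          using \<open>xs = [] \<or> ys = []\<close> sub by (auto simp: adj_append)
        then show ?thesis by blast
      qed
      then have "card ?D \<le> card D + 1"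
        using card_Un_le_insert[OF fin] by blast
      then show ?thesis
        unfolding lenL using sweep_bound_insert_end[OF IH len len1] by blast
    next
      case False
      then have ne: "xs \<noteq> []" "ys \<noteq> []" by auto
      have ends: "hd ?L = hd (xs @ ys)" "last ?L = last (xs @ ys)"
        using ne by auto
      have "adj ?L \<subseteq> insert (last xs, w) (insert (w, hd ys) D)"
        using ne sub by (cases ys) (auto simp: adj_append)
      then have c: "card ?D \<le> card D + 2"
        using card_Un_le_insert2[OF fin] by blast
      have len2: "2 \<le> length (xs @ ys)"
        using ne by (cases xs; cases ys) auto
      \<comment> \<open>Each part is a single vertex here, so the ends are neighbours in
        \<open>xs @ ys\<close>.\<close>
      have "(hd ?L, last ?L) \<in> D" if "i = 2"
      proof -
        have "length xs = 1" "length ys = 1"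
          using that len len2 ne by (cases xs; cases ys; simp)+
        then show ?thesis using sub
          by (auto simp: length_Suc_conv)
      qed
      then show ?thesis
        unfolding lenL using ends by (intro sweep_bound_insert_middle[OF IH len len2 c]) auto
    qed
  qed
  then show ?case using fin len by auto
next
  case (del i d xs w ys D)
  let ?L = "xs @ w # ys" and ?D = "D \<union> adj (xs @ ys)"
  have lenL: "length ?L = Suc (length (xs @ ys))" by simp
  have fin: "finite D" and sub: "adj ?L \<subseteq> D" and len: "i = d + Suc (length (xs @ ys))"
    and IH: "sweep_bound i d (Suc (length (xs @ ys))) (card D) ((hd ?L, last ?L) \<in> D)"
    using del.IH unfolding lenL by auto
  have "sweep_bound i (Suc d) (length (xs @ ys)) (card ?D) ((hd (xs @ ys), last (xs @ ys)) \<in> ?D)"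
  proof (cases "xs = [] \<or> ys = []")
    case True
    have "adj (xs @ ys) \<subseteq> D"
    proof (cases "xs = []")
      case True
      then show ?thesis using sub by (cases ys) auto
    next
      case False
      then show ?thesis using \<open>xs = [] \<or> ys = []\<close> sub by (auto simp: adj_append)
    qed
    then have "?D = D" by auto
    then show ?thesis
      using sweep_bound_delete_end[OF IH len] by simp
  next
    case False
    then have ne: "xs \<noteq> []" "ys \<noteq> []" by auto
    have ends: "hd ?L = hd (xs @ ys)" "last ?L = last (xs @ ys)"
      using ne by auto
    have adj: "adj (xs @ ys) \<subseteq> insert (last xs, hd ys) D"
      using ne sub by (cases ys) (auto simp: adj_append)
    then have le: "card ?D \<le> card D + 1"
      using card_Un_le_insert[OF fin] by blast
    have len2: "2 \<le> length (xs @ ys)"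
      using ne by (cases xs; cases ys) auto
    \<comment> \<open>The only possible new pair is \<open>(last xs, hd ys)\<close>, which for two
      singletons is the pair of ends.\<close>
    have "?D = D" if "length (xs @ ys) = 2" "(hd ?L, last ?L) \<in> D"
    proof -
      have "length xs = 1" "length ys = 1"
        using that ne by (cases xs; cases ys; simp)+
      then show ?thesis using that adj
        by (auto simp: length_Suc_conv)
    qed
    then show ?thesis
      using ends by (intro sweep_bound_delete_middle[OF IH len len2 le]) auto
  qed
  then show ?case using fin len by auto
qed

section \<open>Sweeps over sets of vertices ordered by height\<close>

definition sweep_set ::
  "('a \<Rightarrow> 'b::linorder) \<Rightarrow> nat \<Rightarrow> nat \<Rightarrow> 'a set \<Rightarrow> ('a \<times> 'a) set \<Rightarrow> bool" where
  "sweep_set y i d T D \<longleftrightarrow>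
     (\<exists>L. set L = T \<and> sorted_wrt (\<lambda>u v. y u < y v) L \<and> sweep i d L D)"

text \<open>The strict order by \<open>y\<close> determines the list from \<open>T\<close>, so the
  list can stay hidden. The new vertex goes directly after all lower ones.\<close>

lemma sweep_set_insert:
  assumes "sweep_set y i d T D" "\<forall>v\<in>T. y v \<noteq> y w"
  shows "\<exists>D'. D \<subseteq> D' \<and> sweep_set y (Suc i) d (insert w T) D'"
proof -
  obtain L where L: "set L = T" "sorted_wrt (\<lambda>u v. y u < y v) L" "sweep i d L D"
    using assms(1) unfolding sweep_set_def by blast
  define xs where "xs = takeWhile (\<lambda>v. y v < y w) L"
  define ys where "ys = dropWhile (\<lambda>v. y v < y w) L"
  have L_eq: "L = xs @ ys" by (simp add: xs_def ys_def)
  have sw: "sweep (Suc i) d (xs @ w # ys) (D \<union> adj (xs @ w # ys))"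
    by (rule sweep.ins) (use L(3) L_eq in simp)
  have s: "sorted_wrt (\<lambda>u v. y u < y v) (xs @ ys)" using L(2) L_eq by simp
  have below: "\<forall>v\<in>set xs. y v < y w" unfolding xs_def by (auto dest: set_takeWhileD)
  have above: "\<forall>v\<in>set ys. y w < y v"
  proof (cases ys)
    case (Cons a zs)
    have "\<not> y a < y w" using hd_dropWhile[of "\<lambda>v. y v < y w" L] Cons unfolding ys_def by auto
    moreover have "a \<in> T" using Cons L(1) L_eq by auto
    ultimately have "y w < y a" using assms(2) by fastforce
    then show ?thesis using s Cons unfolding sorted_wrt_append by auto
  qed simp
  have "sorted_wrt (\<lambda>u v. y u < y v) (xs @ w # ys)"
    using s below above unfolding sorted_wrt_append by auto
  moreover have "set (xs @ w # ys) = insert w T"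
    using L(1) L_eq by auto
  ultimately show ?thesis using sw unfolding sweep_set_def by blast
qed

lemma sweep_set_delete:
  assumes "sweep_set y i d T D" "w \<in> T"
  shows "\<exists>D'. D \<subseteq> D' \<and> sweep_set y i (Suc d) (T - {w}) D'"
proof -
  obtain L where L: "set L = T" "sorted_wrt (\<lambda>u v. y u < y v) L" "sweep i d L D"
    using assms(1) unfolding sweep_set_def by blast
  then obtain xs ys where xy: "L = xs @ w # ys"
    using assms(2) by (metis split_list)
  have "sweep i (Suc d) (xs @ ys) (D \<union> adj (xs @ ys))"
    using L(3) xy by (auto intro: sweep.del)
  moreover have "sorted_wrt (\<lambda>u v. y u < y v) (xs @ ys)"
    using L(2) xy by (auto simp: sorted_wrt_append)
  moreover have "set (xs @ ys) = T - {w}"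
    using L(1,2) xy by (fastforce simp: sorted_wrt_append)
  ultimately show ?thesis unfolding sweep_set_def by blast
qed

text \<open>This serves segments that start at the same abscissa, inserted in any order. Neighbours
  in intermediate lists may enter \<open>D'\<close> too, which is harmless for an upper
  bound.\<close>

lemma sweep_set_Un:
  assumes "finite I" "sweep_set y i d T D" "T \<inter> I = {}" "inj_on y (T \<union> I)"
  shows "\<exists>D'. D \<subseteq> D' \<and> sweep_set y (i + card I) d (T \<union> I) D'"
  using assms
proof (induction I rule: finite_induct)
  case (insert w I)
  have "inj_on y (T \<union> I)" using insert.prems(3) by (rule inj_on_subset) auto
  then obtain D' where D': "D \<subseteq> D'" "sweep_set y (i + card I) d (T \<union> I) D'"
    using insert by auto
  have "\<forall>v\<in>T \<union> I. y v \<noteq> y w"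
    using insert.prems(2,3) insert.hyps(2) unfolding inj_on_def by blast
  from sweep_set_insert[OF D'(2) this] obtain D''
    where "D' \<subseteq> D''" "sweep_set y (Suc (i + card I)) d (insert w (T \<union> I)) D''" by blast
  then show ?case
    using D'(1) insert.hyps by (intro exI[of _ D'']) auto
qed auto

lemma sweep_set_Diff:
  assumes "finite I" "sweep_set y i d T D" "I \<subseteq> T"
  shows "\<exists>D'. D \<subseteq> D' \<and> sweep_set y i (d + card I) (T - I) D'"
  using assms
proof (induction I rule: finite_induct)
  case (insert w I)
  then obtain D' where D': "D \<subseteq> D'" "sweep_set y i (d + card I) (T - I) D'"
    by auto
  have "w \<in> T - I" using insert by auto
  moreover have "T - I - {w} = T - insert w I" by auto
  ultimately obtain D''
    where "D' \<subseteq> D''" "sweep_set y i (Suc (d + card I)) (T - insert w I) D''"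
    using sweep_set_delete[OF D'(2), of w] by auto
  then show ?case
    using D'(1) insert.hyps by (intro exI[of _ D'']) auto
qed auto

section \<open>Visibility between horizontal bars and the bound 3n - 6\<close>

lemma adj_sorted_wrt:
  assumes "sorted_wrt (\<lambda>u v. y u < (y v :: 'b::linorder)) L" "u \<in> set L" "v \<in> set L" "y u < y v"
    and gap: "\<forall>w\<in>set L. \<not> (y u < y w \<and> y w < y v)"
  shows "(u, v) \<in> adj L"
proof -
  obtain xs ys where L: "L = xs @ u # ys" using assms(2) by (metis split_list)
  have "v \<in> set ys" using assms(1,3,4) L by (auto simp: sorted_wrt_append)
  then obtain a zs where ys: "ys = a # zs" by (cases ys) auto
  have "a = v"
    using assms(1) gap \<open>v \<in> set ys\<close> by (auto simp: L ys sorted_wrt_append)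
  then show ?thesis by (cases "xs = []") (auto simp: L ys adj_append)
qed

text \<open>Pairs are directed upwards, so each pair of bars counts once. Integer abscissae suffice,
  because edge-segments have grid points as ends.\<close>

definition bar_visible ::
  "'a set \<Rightarrow> ('a \<Rightarrow> int) \<Rightarrow> ('a \<Rightarrow> int) \<Rightarrow> ('a \<Rightarrow> 'b::linorder) \<Rightarrow> int \<Rightarrow> 'a \<Rightarrow> 'a \<Rightarrow> bool" where
  "bar_visible V l r y x u v \<longleftrightarrow>
     u \<in> V \<and> v \<in> V \<and> x \<in> {l u..r u} \<and> x \<in> {l v..r v} \<and> y u < y v \<and>
     (\<forall>w\<in>V. x \<in> {l w..r w} \<longrightarrow> \<not> (y u < y w \<and> y w < y v))"

text \<open>Bars that see each other at \<open>x\<close> are neighbours in the list when the sweep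
  line is at \<open>x\<close>, so all these pairs are collected by one complete sweep.\<close>

theorem card_bar_visible_le:
  fixes y :: "'a \<Rightarrow> 'b::linorder"
  assumes fin: "finite V" and "card V \<ge> 3"
    and lr: "\<And>v. v \<in> V \<Longrightarrow> l v \<le> r v"
    and inj: "\<And>x. inj_on y {v\<in>V. x \<in> {l v..r v}}"
  shows "finite {(u, v). \<exists>x. bar_visible V l r y x u v}"
    and "card {(u, v). \<exists>x. bar_visible V l r y x u v} + 6 \<le> 3 * card V"
proof -
  \<comment> \<open>The state just before abscissa \<open>k\<close> is treated.\<close>
  let ?P = "\<lambda>k. \<exists>D. sweep_set y (card {v\<in>V. l v < k}) (card {v\<in>V. r v < k})
                        {v\<in>V. l v < k \<and> k \<le> r v} D \<and>
                    (\<forall>x<k. \<forall>u v. bar_visible V l r y x u v \<longrightarrow> (u, v) \<in> D)"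
  obtain a where a: "\<And>v. v \<in> V \<Longrightarrow> a \<le> l v"
    using fin by (meson bdd_below_finite bdd_below.unfold finite_imageI imageI)
  obtain b0 where b0: "\<And>v. v \<in> V \<Longrightarrow> r v \<le> b0"
    using fin by (meson bdd_above_finite bdd_above.unfold finite_imageI imageI)
  \<comment> \<open>\<open>b0 + 1\<close> lies beyond all right ends, so the sweep is complete at
    \<open>b\<close>; the maximum with \<open>a\<close> permits induction upwards from
    \<open>a\<close>.\<close>
  define b where "b = max a (b0 + 1)"
  have b: "\<And>v. v \<in> V \<Longrightarrow> r v < b" using b0 unfolding b_def by fastforce
  have "a \<le> b" unfolding b_def by simp
  then have "?P b"
  proof (induction b rule: int_ge_induct)
    case base
    have e: "{v\<in>V. l v < a} = {}" "{v\<in>V. r v < a} = {}" "{v\<in>V. l v < a \<and> a \<le> r v} = {}"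
      using a lr by fastforce+
    have "sweep_set y 0 0 {} {}" unfolding sweep_set_def using sweep.start by fastforce
    moreover have "\<not> bar_visible V l r y x u v" if "x < a" for x u v
      using a that unfolding bar_visible_def by fastforce
    ultimately show ?case unfolding e by auto
  next
    case (step k)
    then obtain D where D: "sweep_set y (card {v\<in>V. l v < k}) (card {v\<in>V. r v < k})
                        {v\<in>V. l v < k \<and> k \<le> r v} D"
      and vis: "\<forall>x<k. \<forall>u v. bar_visible V l r y x u v \<longrightarrow> (u, v) \<in> D" by blast
    \<comment> \<open>Segments are closed, so at \<open>k\<close> all insertions precede all
      deletions. In between, the list consists of \<open>?A\<close>, the segments met by the line at
      \<open>k\<close>, and visibilities at \<open>k\<close> are read off there.\<close>
    let ?I = "{v\<in>V. l v = k}" and ?R = "{v\<in>V. r v = k}"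
    let ?A = "{v\<in>V. k \<in> {l v..r v}}"
    have A: "{v\<in>V. l v < k \<and> k \<le> r v} \<union> ?I = ?A" using lr by fastforce
    have cl: "card {v\<in>V. l v < k} + card ?I = card {v\<in>V. l v < k + 1}"
      using fin by (subst card_Un_disjoint[symmetric]) (auto intro!: arg_cong[where f = card])
    have cr: "card {v\<in>V. r v < k} + card ?R = card {v\<in>V. r v < k + 1}"
      using fin by (subst card_Un_disjoint[symmetric]) (auto intro!: arg_cong[where f = card])
    obtain D1 where D1: "D \<subseteq> D1"
      "sweep_set y (card {v\<in>V. l v < k + 1}) (card {v\<in>V. r v < k}) ?A D1"
      using sweep_set_Un[OF _ D, of ?I] fin inj[of k] unfolding A cl by fastforce
    have RA: "?R \<subseteq> ?A" using lr by fastforce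
    have T: "?A - ?R = {v\<in>V. l v < k + 1 \<and> k + 1 \<le> r v}" using lr by fastforce
    obtain D2 where D2: "D1 \<subseteq> D2"
      "sweep_set y (card {v\<in>V. l v < k + 1}) (card {v\<in>V. r v < k + 1})
         {v\<in>V. l v < k + 1 \<and> k + 1 \<le> r v} D2"
      using sweep_set_Diff[OF _ D1(2) RA] fin unfolding T cr by auto
    have "(u, v) \<in> D2" if "x < k + 1" "bar_visible V l r y x u v" for x u v
    proof (cases "x < k")
      case True
      then show ?thesis using vis that D1(1) D2(1) by blast
    next
      case False
      then have x: "x = k" using that by simp
      obtain L where L: "set L = ?A" "sorted_wrt (\<lambda>u v. y u < y v) L"
        "sweep (card {v\<in>V. l v < k + 1}) (card {v\<in>V. r v < k}) L D1"
        using D1(2) unfolding sweep_set_def by blast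
      have "(u, v) \<in> adj L"
        using that(2) unfolding x bar_visible_def
        by (intro adj_sorted_wrt[OF L(2)]) (simp_all add: L(1))
      then show ?thesis using sweep_invariant[OF L(3)] D2(1) by auto
    qed
    then show ?case using D2(2) by blast
  qed
  moreover have "{v\<in>V. l v < b} = V" "{v\<in>V. r v < b} = V" "{v\<in>V. l v < b \<and> b \<le> r v} = {}"
    using b lr by fastforce+
  ultimately obtain D where D: "sweep_set y (card V) (card V) {} D"
    and vis: "\<forall>x<b. \<forall>u v. bar_visible V l r y x u v \<longrightarrow> (u, v) \<in> D" by auto
  have "sweep (card V) (card V) [] D" using D unfolding sweep_set_def by simp
  from sweep_invariant[OF this] have finD: "finite D" and "card D + 6 \<le> 3 * card V"
    using assms(2) unfolding sweep_bound_def by auto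
  moreover have sub: "{(u, v). \<exists>x. bar_visible V l r y x u v} \<subseteq> D"
  proof clarify
    fix u v x assume "bar_visible V l r y x u v"
    moreover from this have "x < b" using b unfolding bar_visible_def by fastforce
    ultimately show "(u, v) \<in> D" using vis by blast
  qed
  ultimately show "card {(u, v). \<exists>x. bar_visible V l r y x u v} + 6 \<le> 3 * card V"
    using card_mono[OF finD sub] by linarith
  show "finite {(u, v). \<exists>x. bar_visible V l r y x u v}"
    using finite_subset[OF sub finD] .
qed

section \<open>Segments in coordinates\<close>

lemma mem_closed_segment_horizontal:
  fixes a b c y z :: real
  shows "(z, y) \<in> closed_segment (a, c) (b, c) \<longleftrightarrow> y = c \<and> min a b \<le> z \<and> z \<le> max a b"
proof -
  have "(z, y) \<in> closed_segment (a, c) (b, c) \<longleftrightarrow> y = c \<and> z \<in> closed_segment a b"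
    by (auto simp: in_segment scaleR_left_distrib[symmetric] distrib_right[symmetric])
  then show ?thesis by (cases "a \<le> b") (simp_all add: closed_segment_eq_real_ivl)
qed

lemma mem_closed_segment_vertical:
  fixes a b c y z :: real
  shows "(y, z) \<in> closed_segment (c, a) (c, b) \<longleftrightarrow> y = c \<and> min a b \<le> z \<and> z \<le> max a b"
proof -
  have "(y, z) \<in> closed_segment (c, a) (c, b) \<longleftrightarrow> y = c \<and> z \<in> closed_segment a b"
    by (auto simp: in_segment scaleR_left_distrib[symmetric] distrib_right[symmetric])
  then show ?thesis by (cases "a \<le> b") (simp_all add: closed_segment_eq_real_ivl)
qed

lemma vertex_segmentE:
  assumes "vertex_segment S"
  obtains l r :: int and y :: real where "l \<le> r"
    "S = {real_of_int l..real_of_int r} \<times> {y}"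
proof -
  obtain p q where pq: "grid_point p" "grid_point q" "snd p = snd q" "S = closed_segment p q"
    using assms unfolding vertex_segment_def by blast
  obtain a b where ab: "fst p = real_of_int a" "fst q = real_of_int b"
    using pq(1,2) unfolding grid_point_def by (meson Ints_cases)
  have "S = closed_segment (real_of_int a, snd p) (real_of_int b, snd p)"
    using pq(3,4) ab by (metis prod.collapse)
  then have "S = {real_of_int (min a b)..real_of_int (max a b)} \<times> {snd p}"
    by (auto simp: mem_closed_segment_horizontal of_int_min of_int_max)
  then show thesis by (intro that[of "min a b" "max a b"]) auto
qed

section \<open>Counting uncrossed and crossing edges of a representation\<close>

theorem corollary2:
  fixes V :: "'a set" and E :: "'a set set" and n :: nat
  assumes "n \<ge> 3"
    and "one_visibility_graph V E"
    and "card V = n"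
  shows "card E \<le> 4 * n - 8"
proof -
  obtain \<Gamma>V \<Gamma>E where G: "simple_graph V E" and R: "one_visibility_representation V E \<Gamma>V \<Gamma>E"
    using assms(2) unfolding one_visibility_graph_def by blast
  have finV: "finite V" and EV: "\<And>e. e \<in> E \<Longrightarrow> e \<subseteq> V \<and> card e = 2"
    using G unfolding simple_graph_def by auto
  have finE: "finite E" using EV finV by (auto intro: finite_subset[of E "Pow V"])
  have RV: "\<forall>v\<in>V. vertex_segment (\<Gamma>V v)"
    and RE: "\<forall>u\<in>V. \<forall>v\<in>V. {u, v} \<in> E \<longrightarrow> edge_segment (\<Gamma>V u) (\<Gamma>V v) (\<Gamma>E {u, v})"
    and RD: "\<forall>u\<in>V. \<forall>v\<in>V. u \<noteq> v \<longrightarrow> \<Gamma>V u \<inter> \<Gamma>V v = {}"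
    and RC: "\<forall>w\<in>V. \<exists>\<^sub>\<le>\<^sub>1e. e \<in> E \<and> crosses \<Gamma>V \<Gamma>E e w"
    using R unfolding one_visibility_representation_def by - (elim conjE, assumption)+
  have "\<forall>v\<in>V. \<exists>l r y. (l::int) \<le> r \<and> \<Gamma>V v = {real_of_int l..real_of_int r} \<times> {y}"
  proof
    fix v assume "v \<in> V"
    then have "vertex_segment (\<Gamma>V v)" using RV by blast
    then show "\<exists>l r y. (l::int) \<le> r \<and> \<Gamma>V v = {real_of_int l..real_of_int r} \<times> {y}"
      by (rule vertex_segmentE) blast
  qed
  then obtain l r y where lr: "\<And>v. v \<in> V \<Longrightarrow> (l v :: int) \<le> r v"
    and seg: "\<And>v. v \<in> V \<Longrightarrow> \<Gamma>V v = {real_of_int (l v)..real_of_int (r v)} \<times> {y v}"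
    by metis
  \<comment> \<open>Equal heights over a common abscissa would give a common point of two disjoint
    vertex-segments.\<close>
  have inj: "inj_on y {v\<in>V. x \<in> {l v..r v}}" for x
  proof (rule inj_onI, rule ccontr)
    fix u v assume uv: "u \<in> {v\<in>V. x \<in> {l v..r v}}" "v \<in> {v\<in>V. x \<in> {l v..r v}}" "y u = y v" "u \<noteq> v"
    then have "(real_of_int x, y u) \<in> \<Gamma>V u \<inter> \<Gamma>V v" by (auto simp: seg)
    then show False using RD uv by blast
  qed
  \<comment> \<open>Here \<open>u\<close> is the lower end of the edge and \<open>v\<close> the
    upper one. The heights differ because points of disjoint vertex-segments on one vertical line
    are distinct.\<close>
  have edge: "\<exists>u v x. e = {u, v} \<and> u \<in> V \<and> v \<in> V \<and> x \<in> {l u..r u} \<and> x \<in> {l v..r v} \<and> y u < y v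
       \<and> \<Gamma>E e = {real_of_int x} \<times> {y u..y v}" if e: "e \<in> E" for e
  proof -
    obtain u v where uv: "e = {u, v}" "u \<noteq> v" using EV[OF e] by (auto simp: card_2_iff)
    then have V: "u \<in> V" "v \<in> V" using EV[OF e] by auto
    then have "edge_segment (\<Gamma>V u) (\<Gamma>V v) (\<Gamma>E e)" using RE e uv(1) by blast
    then obtain p q where p: "p \<in> \<Gamma>V u" "grid_point p" and q: "q \<in> \<Gamma>V v"
      and pq: "fst p = fst q" "\<Gamma>E e = closed_segment p q"
      unfolding edge_segment_def by blast
    obtain x where x: "fst p = real_of_int x"
      using p(2) unfolding grid_point_def by (meson Ints_cases)
    have p': "p = (real_of_int x, y u)" "x \<in> {l u..r u}" using p(1) x by (auto simp: seg V)
    have q': "q = (real_of_int x, y v)" "x \<in> {l v..r v}" using q x pq(1) by (auto simp: seg V)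
    have "p \<noteq> q" using RD V uv(2) p(1) q by blast
    then have "y u \<noteq> y v" unfolding p'(1) q'(1) by simp
    moreover have segE: "\<Gamma>E e = {real_of_int x} \<times> {min (y u) (y v)..max (y u) (y v)}"
      unfolding pq(2) p'(1) q'(1) by (auto simp: mem_closed_segment_vertical)
    ultimately show ?thesis
    proof (cases "y u < y v")
      case True
      with segE show ?thesis using uv(1) V p'(2) q'(2) by (intro exI[of _ u] exI[of _ v] exI[of _ x]) auto
    next
      case False
      with segE \<open>y u \<noteq> y v\<close> show ?thesis
        using uv(1) V p'(2) q'(2) by (intro exI[of _ v] exI[of _ u] exI[of _ x]) auto
    qed
  qed
  define C where "C = {e\<in>E. \<exists>w\<in>V. crosses \<Gamma>V \<Gamma>E e w}"
  let ?B = "{(u, v). \<exists>x. bar_visible V l r y x u v}"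
  have "card (E - C) + 6 \<le> 3 * n"
  proof -
    \<comment> \<open>A segment strictly between the ends on the line at \<open>x\<close> would be
      crossed, so the ends of an edge outside \<open>C\<close> see each other there.\<close>
    have sub: "E - C \<subseteq> (\<lambda>(u, v). {u, v}) ` ?B"
    proof
      fix e assume e: "e \<in> E - C"
      then obtain u v x where uv: "e = {u, v}" "u \<in> V" "v \<in> V" "x \<in> {l u..r u}" "x \<in> {l v..r v}"
        "y u < y v" "\<Gamma>E e = {real_of_int x} \<times> {y u..y v}" using edge[of e] by blast
      have "\<not> (y u < y w \<and> y w < y v)" if w: "w \<in> V" "x \<in> {l w..r w}" for w
      proof
        assume yw: "y u < y w \<and> y w < y v"
        then have "(real_of_int x, y w) \<in> \<Gamma>E e \<inter> \<Gamma>V w" using w uv(7) by (auto simp: seg)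
        moreover have "w \<notin> e" using yw uv(1) by auto
        ultimately show False using e w(1) unfolding C_def crosses_def by blast
      qed
      then have "bar_visible V l r y x u v" unfolding bar_visible_def using uv by blast
      then show "e \<in> (\<lambda>(u, v). {u, v}) ` ?B" using uv(1) by force
    qed
    have B: "finite ?B" "card ?B + 6 \<le> 3 * card V"
      using card_bar_visible_le[OF finV _ lr inj] assms(1,3) by auto
    have "card (E - C) \<le> card ?B" by (rule surj_card_le[OF B(1) sub])
    then show ?thesis using B(2) assms(3) by linarith
  qed
  moreover have "card C + 2 \<le> n"
  proof (cases "C = {}")
    case True
    then show ?thesis using assms(1) by simp
  next
    case False
    have "\<forall>e\<in>C. \<exists>w. w \<in> V \<and> crosses \<Gamma>V \<Gamma>E e w" unfolding C_def by blast
    \<comment> \<open>\<open>g e\<close> is a vertex whose segment \<open>e\<close> crosses; since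
      each is crossed at most once, \<open>g\<close> is injective on \<open>C\<close>.\<close>
    then obtain g where g: "\<And>e. e \<in> C \<Longrightarrow> g e \<in> V \<and> crosses \<Gamma>V \<Gamma>E e (g e)" by metis
    have injg: "inj_on g C"
    proof (rule inj_onI)
      fix e f assume ef: "e \<in> C" "f \<in> C" "g e = g f"
      then have "crosses \<Gamma>V \<Gamma>E e (g e)" "crosses \<Gamma>V \<Gamma>E f (g e)" "g e \<in> V" "e \<in> E" "f \<in> E"
        using g[of e] g[of f] by (auto simp: C_def)
      then show "e = f" using RC unfolding Uniq_def by blast
    qed
    have between: "\<exists>u\<in>V. \<exists>v\<in>V. y u < y (g e) \<and> y (g e) < y v" if e: "e \<in> C" for e
    proof -
      obtain u v x where uv: "e = {u, v}" "u \<in> V" "v \<in> V" "x \<in> {l u..r u}" "x \<in> {l v..r v}"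
        "\<Gamma>E e = {real_of_int x} \<times> {y u..y v}" using edge[of e] e unfolding C_def by blast
      have w: "g e \<in> V" "g e \<notin> e" "\<Gamma>E e \<inter> \<Gamma>V (g e) \<noteq> {}"
        using g[OF e] unfolding crosses_def by auto
      then have x: "x \<in> {l (g e)..r (g e)}" "y u \<le> y (g e)" "y (g e) \<le> y v"
        unfolding uv(6) seg[OF w(1)] by auto
      \<comment> \<open>Contact at an end of \<open>e\<close> is excluded: equal height at abscissa
        \<open>x\<close> would force \<open>g e\<close> to be an end of \<open>e\<close>.\<close>
      then have "y u \<noteq> y (g e)" "y (g e) \<noteq> y v"
        using inj_onD[OF inj[of x], of u "g e"] inj_onD[OF inj[of x], of v "g e"] uv(1-5) w(1,2)
        by auto
      then show ?thesis using x uv(2,3) by force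
    qed
    have "V \<noteq> {}" using assms(1,3) by auto
    \<comment> \<open>A lowest and a highest vertex, both missed by \<open>g\<close>. They are
      distinct because a crossing edge exists, which leaves \<open>n - 2\<close> values for
      \<open>g\<close>.\<close>
    then obtain b t where "is_arg_min y (\<lambda>v. v \<in> V) b" "is_arg_min (\<lambda>v. - y v) (\<lambda>v. v \<in> V) t"
      using ex_is_arg_min_if_finite[OF finV] by blast
    then have b: "b \<in> V" "\<And>v. v \<in> V \<Longrightarrow> y b \<le> y v"
      and t: "t \<in> V" "\<And>v. v \<in> V \<Longrightarrow> y v \<le> y t"
      unfolding is_arg_min_linorder by auto
    have "g e \<in> V - {b, t}" if e: "e \<in> C" for e
    proof -
      obtain u v where "u \<in> V" "v \<in> V" "y u < y (g e)" "y (g e) < y v" using between[OF e] by blast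
      then have "g e \<noteq> b" "g e \<noteq> t" using b(2)[of u] t(2)[of v] by auto
      then show ?thesis using g[OF e] by blast
    qed
    then have "g ` C \<subseteq> V - {b, t}" by blast
    then have "card C \<le> card (V - {b, t})"
      using card_image[OF injg] finV by (metis card_mono finite_Diff)
    moreover have "b \<noteq> t"
    proof -
      obtain e u v where "u \<in> V" "v \<in> V" "y u < y (g e)" "y (g e) < y v"
        using False between by blast
      then have "y b < y t" using b(2)[of u] t(2)[of v] by linarith
      then show ?thesis by auto
    qed
    ultimately show ?thesis using b(1) t(1) assms(1,3) finV by (simp add: card_Diff_subset)
  qed
  moreover have "card E = card (E - C) + card C"
    using card_Diff_subset[of C E] card_mono[OF finE, of C] finE finite_subset[of C E]
    unfolding C_def by fastforce
  ultimately show ?thesis by linarith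
qed

end
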